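(* Suppose each $f_i:\mathbb{R}^d\to\mathbb{R}$ ($i\in[n]$) is $\mu$-strongly convex and $L$-smooth, let $0<\alpha\le \frac{2}{\mu+L}$ and $\theta\in(0,1)$. Let $(x^t)_{t\ge 0}$ be generated by Prox-DFinito with step-size $\alpha$, damping parameter $\theta$, initialization $\boldsymbol{z}^0\in\mathbb{R}^{nd}$, and shuffling-once sampling (a uniformly random permutation $\pi$ of $[n]$ is drawn once before training begins and is then used as the cyclic order in all epochs). Then for every $k=0,1,2,\dots$ $$\mathbb{E}\,\|x^{kn}-x^\star\|^2\le\Big(1-\frac{2\theta\alpha\mu L}{\mu+L}\Big)^k C,\qquad C=\frac{(n+1)(\log(n)+1)}{2n^2}\|\boldsymbol{z}^0-\boldsymbol{z}^\star\|^2 ,$$ where the expectation is over $\pi$.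
   Context: Problem: $\min_{x\in\mathbb{R}^d}F(x)+r(x)$ with $F=\frac1n\sum_{i=1}^n f_i$, each $f_i$ differentiable, and $r:\mathbb{R}^d\to\mathbb{R}\cup\{+\infty\}$ convex, closed and proper (not necessarily differentiable). $[n]=\{1,\dots,n\}$; $L\ge\mu>0$, and $L$-smooth means the gradient is $L$-Lipschitz. $\mathrm{prox}_{\alpha r}(x)=\arg\min_{y}\{\alpha r(y)+\frac12\|y-x\|^2\}$. $\|\cdot\|$ is the Euclidean norm. $x^\star$ is the minimizer of $F+r$, and $\boldsymbol{z}^\star=\mathrm{col}\{z_1^\star,\dots,z_n^\star\}\in\mathbb{R}^{nd}$ (stacked vector) with $z_i^\star=x^\star-\alpha\nabla f_i(x^\star)$. Prox-DFinito: given (deterministic) $\boldsymbol{z}^0=\mathrm{col}\{z_1^0,\dots,z_n^0\}$, set $\bar z^0=\frac1n\sum_i z_i^0$. For each epoch $k=0,1,2,\dots$: for $t=kn+1,\dots,(k+1)n$, set $x^{t-1}=\mathrm{prox}_{\alpha r}(\bar z^{t-1})$, pick an index $i_t$, set $z_{i_t}^t=x^{t-1}-\alpha\nabla f_{i_t}(x^{t-1})$, $z_i^t=z_i^{t-1}$ for $i\ne i_t$, and $\bar z^t=\bar z^{t-1}+(z_{i_t}^t-z_{i_t}^{t-1})/n$. At the end of the epoch apply the damping step: overwrite $z_i^{(k+1)n}\leftarrow(1-\theta)z_i^{kn}+\theta z_i^{(k+1)n}$ for all $i$ and $\bar z^{(k+1)n}\leftarrow(1-\theta)\bar z^{kn}+\theta\bar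 z^{(k+1)n}$. Thus $x^{kn}=\mathrm{prox}_{\alpha r}(\bar z^{kn})$ with the damped $\bar z^{kn}$. Cyclic order $\pi$ means $i_{kn+j}=\pi(j)$ for all epochs $k$ and $j\in[n]$. *)

theory Defs
  imports "HOL-Probability.Probability" "HOL-Combinatorics.Permutations"
begin

section \<open>Convex-analytic notions\<close>

definition grad :: "('a::real_inner \<Rightarrow> real) \<Rightarrow> 'a \<Rightarrow> 'a" where
  "grad f x = (THE g. GDERIV f x :> g)"

definition L_smooth :: "real \<Rightarrow> ('a::real_inner \<Rightarrow> real) \<Rightarrow> bool" where
  "L_smooth L f \<longleftrightarrow> (\<forall>x. f differentiable (at x)) \<and> L-lipschitz_on UNIV (grad f)"

definition strongly_convex :: "real \<Rightarrow> ('a::real_inner \<Rightarrow> real) \<Rightarrow> bool" where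
  "strongly_convex \<mu> f \<longleftrightarrow>
     (\<forall>x y. \<forall>t\<in>{0..1}. f ((1 - t) *\<^sub>R x + t *\<^sub>R y)
        \<le> (1 - t) * f x + t * f y - \<mu> / 2 * (1 - t) * t * (norm (x - y))\<^sup>2)"

definition ereal_epigraph :: "('a \<Rightarrow> ereal) \<Rightarrow> ('a \<times> real) set" where
  "ereal_epigraph r = {(x, s). r x \<le> ereal s}"

definition convex_fun :: "('a::real_vector \<Rightarrow> ereal) \<Rightarrow> bool" where
  "convex_fun r \<longleftrightarrow> convex (ereal_epigraph r)"

definition closed_fun :: "('a::topological_space \<Rightarrow> ereal) \<Rightarrow> bool" where
  "closed_fun r \<longleftrightarrow> closed (ereal_epigraph r)"

definition proper_fun :: "('a \<Rightarrow> ereal) \<Rightarrow> bool" where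
  "proper_fun r \<longleftrightarrow> (\<forall>x. r x \<noteq> -\<infinity>) \<and> (\<exists>x. r x \<noteq> \<infinity>)"

definition prox :: "real \<Rightarrow> ('a::real_normed_vector \<Rightarrow> ereal) \<Rightarrow> 'a \<Rightarrow> 'a" where
  "prox \<alpha> r x = (ARG_MIN (\<lambda>y. ereal \<alpha> * r y + ereal (1 / 2 * (norm (y - x))\<^sup>2)) y. True)"

section \<open>The composite problem\<close>

definition avg :: "nat \<Rightarrow> (nat \<Rightarrow> 'b::real_vector) \<Rightarrow> 'b" where
  "avg n v = (1 / real n) *\<^sub>R (\<Sum>i\<in>{1..n}. v i)"

text \<open>No existence hypothesis is attached to \<open>optimum\<close>: under strong convexity of the
  \<open>f i\<close> and convexity, closedness and properness of \<open>r\<close> the minimizer exists and is unique.\<close>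

definition optimum :: "nat \<Rightarrow> (nat \<Rightarrow> 'a \<Rightarrow> real) \<Rightarrow> ('a \<Rightarrow> ereal) \<Rightarrow> 'a" where
  "optimum n f r = (ARG_MIN (\<lambda>x. ereal (avg n (\<lambda>i. f i x)) + r x) x. True)"

definition zstar :: "nat \<Rightarrow> real \<Rightarrow> (nat \<Rightarrow> 'a::real_inner \<Rightarrow> real) \<Rightarrow> ('a \<Rightarrow> ereal) \<Rightarrow> nat \<Rightarrow> 'a" where
  "zstar n \<alpha> f r i = optimum n f r - \<alpha> *\<^sub>R grad (f i) (optimum n f r)"

text \<open>A stacked vector \<open>col{z\<^sub>1, \<dots>, z\<^sub>n}\<close> is a function on \<open>nat\<close> of which only
  the blocks \<open>1, \<dots>, n\<close> are relevant.\<close>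

definition stacked_norm :: "nat \<Rightarrow> (nat \<Rightarrow> 'a::real_normed_vector) \<Rightarrow> real" where
  "stacked_norm n z = L2_set (\<lambda>i. norm (z i)) {1..n}"

section \<open>Prox-DFinito\<close>

text \<open>A state is the pair of the blocks \<open>z\<close> and the running average \<open>zb\<close>. The argument
  \<open>idx\<close> is the index sequence, \<open>idx t\<close> being the index picked at iteration \<open>t \<ge> 1\<close>.\<close>

type_synonym 'a state = "(nat \<Rightarrow> 'a) \<times> 'a"

definition update ::
  "nat \<Rightarrow> real \<Rightarrow> (nat \<Rightarrow> 'a::real_inner \<Rightarrow> real) \<Rightarrow> ('a \<Rightarrow> ereal) \<Rightarrow> nat \<Rightarrow> 'a state \<Rightarrow> 'a state" where
  "update n \<alpha> f r i = (\<lambda>(z, zb).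
     let x = prox \<alpha> r zb;
         w = x - \<alpha> *\<^sub>R grad (f i) x
     in (z(i := w), zb + (1 / real n) *\<^sub>R (w - z i)))"

definition damp :: "real \<Rightarrow> 'a::real_vector state \<Rightarrow> 'a state \<Rightarrow> 'a state" where
  "damp \<theta> = (\<lambda>(z, zb) (z', zb').
     (\<lambda>i. (1 - \<theta>) *\<^sub>R z i + \<theta> *\<^sub>R z' i, (1 - \<theta>) *\<^sub>R zb + \<theta> *\<^sub>R zb'))"

text \<open>\<open>updates \<dots> t0 j s\<close> performs iterations \<open>t0 + 1, \<dots>, t0 + j\<close>, without damping,
  from the state \<open>s\<close> at time \<open>t0\<close>.\<close>

primrec updates ::
  "nat \<Rightarrow> real \<Rightarrow> (nat \<Rightarrow> 'a::real_inner \<Rightarrow> real) \<Rightarrow> ('a \<Rightarrow> ereal) \<Rightarrow> (nat \<Rightarrow> nat) \<Rightarrow> nat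
     \<Rightarrow> nat \<Rightarrow> 'a state \<Rightarrow> 'a state" where
  "updates n \<alpha> f r idx t0 0 s = s"
| "updates n \<alpha> f r idx t0 (Suc j) s =
     update n \<alpha> f r (idx (t0 + Suc j)) (updates n \<alpha> f r idx t0 j s)"

text \<open>The (damped) state at time \<open>k n\<close>.\<close>

primrec epoch_state ::
  "nat \<Rightarrow> real \<Rightarrow> real \<Rightarrow> (nat \<Rightarrow> 'a::real_inner \<Rightarrow> real) \<Rightarrow> ('a \<Rightarrow> ereal) \<Rightarrow> (nat \<Rightarrow> nat)
     \<Rightarrow> (nat \<Rightarrow> 'a) \<Rightarrow> nat \<Rightarrow> 'a state" where
  "epoch_state n \<alpha> \<theta> f r idx z0 0 = (z0, avg n z0)"
| "epoch_state n \<alpha> \<theta> f r idx z0 (Suc k) =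
     (let s = epoch_state n \<alpha> \<theta> f r idx z0 k
      in damp \<theta> s (updates n \<alpha> f r idx (k * n) n s))"

text \<open>The iterate \<open>x\<^sup>t\<close> for every \<open>t \<ge> 0\<close>: \<open>t mod n\<close> updates after the last damped state.\<close>

definition prox_DFinito ::
  "nat \<Rightarrow> real \<Rightarrow> real \<Rightarrow> (nat \<Rightarrow> 'a::real_inner \<Rightarrow> real) \<Rightarrow> ('a \<Rightarrow> ereal) \<Rightarrow> (nat \<Rightarrow> nat)
     \<Rightarrow> (nat \<Rightarrow> 'a) \<Rightarrow> nat \<Rightarrow> 'a" where
  "prox_DFinito n \<alpha> \<theta> f r idx z0 t =
     prox \<alpha> r (snd (updates n \<alpha> f r idx (t div n * n) (t mod n)
                      (epoch_state n \<alpha> \<theta> f r idx z0 (t div n))))"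

text \<open>The index sequence with \<open>idx (k n + j) = \<pi> j\<close> for \<open>1 \<le> j \<le> n\<close>.\<close>

definition cyclic_order :: "nat \<Rightarrow> (nat \<Rightarrow> nat) \<Rightarrow> nat \<Rightarrow> nat" where
  "cyclic_order n \<pi> t = \<pi> ((t - 1) mod n + 1)"

definition uniform_perm :: "nat \<Rightarrow> (nat \<Rightarrow> nat) pmf" where
  "uniform_perm n = pmf_of_set {\<pi>. \<pi> permutes {1..n}}"

end

(* Both gradient steps and prox are controlled in norm: x - alpha grad f_i(x) contracts squared
   distances by rho = 1 - 2 alpha mu L / (mu + L), and prox is nonexpansive. Hence a refreshed block
   has squared error at most rho times the mean squared error of all blocks. Weighting the block
   refreshed j-th in the sweep by j, the weighted squared error contracts by rho over one sweep,
   and damping turns rho into 1 - theta (1 - rho). By Cauchy-Schwarz with these weights the squared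
   error of the average costs a harmonic number, and the uniform random permutation averages the
   initial weights to (n + 1) / 2. *)

theory Submission
  imports Defs
begin

text \<open>The weight j comes from a count. During one sweep the old value of the block refreshed
  j-th is read by exactly j of the n averages, its new value by the other n - j. Adding the n
  refresh inequalities and moving the new values to the left leaves n - (n - j) = j there too, so
  the same weights appear on both sides. Equal weights would not do: if all the error sits in the
  block refreshed last, the refresh inequalities with \<open>\<rho>\<close> near 1 and n at least 2
  allow the plain sum to grow. The contraction holds for each permutation separately; the
  expectation enters once, through the order in which the initial errors are weighted. A separate
  burden is that \<open>prox\<close> and \<open>optimum\<close> are chosen minimizers of
  extended-valued functions, so existence has to be proved before anything is known about them.
  Their optimality conditions then show that the optimum is the prox image of the mean of the blocks
  of \<open>zstar\<close>, the reference point for all errors.\<close>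

section \<open>Gradients of strongly convex and smooth functions\<close>

text \<open>Since \<open>grad\<close> is a definite description, both existence and uniqueness are
  due: the coordinates of the derivative in the orthonormal basis give a gradient, and nondegeneracy
  of the inner product excludes a second one.\<close>

lemma GDERIV_grad:
  fixes f :: "'a::euclidean_space \<Rightarrow> real"
  assumes "f differentiable (at x)"
  shows "GDERIV f x :> grad f x"
proof -
  obtain f' where f': "(f has_derivative f') (at x)"
    using assms by (auto simp: differentiable_def)
  then interpret bounded_linear f' by (rule has_derivative_bounded_linear)
  let ?g = "\<Sum>b\<in>Basis. f' b *\<^sub>R b"
  have "f' h = inner h ?g" for h
  proof -
    have "f' h = f' (\<Sum>b\<in>Basis. inner h b *\<^sub>R b)" by (simp add: euclidean_representation)
    also have "\<dots> = inner h ?g" by (simp add: sum scaleR inner_sum_right mult.commute)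
    finally show ?thesis .
  qed
  then have "f' = (\<lambda>h. inner h ?g)" by (rule ext)
  then have g: "GDERIV f x :> ?g" using f' unfolding gderiv_def by simp
  moreover have "g' = ?g" if "GDERIV f x :> g'" for g'
  proof -
    have "(\<lambda>h. inner h g') = (\<lambda>h. inner h ?g)"
      by (rule has_derivative_unique[OF that[unfolded gderiv_def] g[unfolded gderiv_def]])
    then have "\<forall>h. inner h g' = inner h ?g" by (rule fun_cong[THEN allI])
    then show ?thesis by (simp only: vector_eq_ldot)
  qed
  ultimately show ?thesis unfolding grad_def by (rule theI)
qed

lemma GDERIV_imp_DERIV_line:
  assumes "GDERIV f (x + t *\<^sub>R d) :> g"
  shows "((\<lambda>t. f (x + t *\<^sub>R d)) has_real_derivative inner d g) (at t)"
proof -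
  have "((\<lambda>t. x + t *\<^sub>R d) has_derivative (\<lambda>s. s *\<^sub>R d)) (at t)"
    by (auto intro!: derivative_eq_intros)
  from has_derivative_compose[OF this assms[unfolded gderiv_def]]
  show ?thesis by (simp add: has_field_derivative_def mult_commute_abs)
qed

text \<open>The limit is one-sided because convexity controls the quotient only for small positive
  \<open>t\<close>, towards the second endpoint of a segment.\<close>

lemma GDERIV_imp_quotient_tendsto:
  assumes "GDERIV f x :> g"
  shows "((\<lambda>t. (f (x + t *\<^sub>R d) - f x) / t) \<longlongrightarrow> inner d g) (at_right 0)"
proof -
  have "((\<lambda>t. f (x + t *\<^sub>R d)) has_real_derivative inner d g) (at 0)"
    by (rule GDERIV_imp_DERIV_line) (use assms in simp)
  then show ?thesis
    by (simp add: has_field_derivative_iff filterlim_at_split)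
qed

lemma strongly_convex_first_order:
  assumes sc: "strongly_convex \<mu> f" and g: "GDERIV f x :> g"
  shows "f x + inner (y - x) g + \<mu> / 2 * (norm (y - x))\<^sup>2 \<le> f y"
proof -
  let ?q = "\<lambda>t. (f (x + t *\<^sub>R (y - x)) - f x) / t"
  let ?b = "\<lambda>t::real. f y - f x - \<mu> / 2 * (1 - t) * (norm (y - x))\<^sup>2"
  have "?q t \<le> ?b t" if "0 < t" "t < 1" for t
  proof -
    have "x + t *\<^sub>R (y - x) = (1 - t) *\<^sub>R x + t *\<^sub>R y" by (simp add: algebra_simps)
    then have "f (x + t *\<^sub>R (y - x)) \<le> (1 - t) * f x + t * f y - \<mu> / 2 * (1 - t) * t * (norm (x - y))\<^sup>2"
      using sc that unfolding strongly_convex_def by simp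
    then show ?thesis using that by (simp add: norm_minus_commute field_simps)
  qed
  then have "eventually (\<lambda>t. ?q t \<le> ?b t) (at_right 0)"
    using eventually_at_right_real[of 0 1] by (auto elim!: eventually_mono)
  moreover have "(?b \<longlongrightarrow> ?b 0) (at_right 0)"
    by (intro tendsto_intros)
  ultimately have "inner (y - x) g \<le> ?b 0"
    using GDERIV_imp_quotient_tendsto[OF g, of "y - x"]
    by (intro tendsto_le[OF _ _ GDERIV_imp_quotient_tendsto[OF g]]) auto
  then show ?thesis by simp
qed

text \<open>Along the segment from \<open>x\<close> to \<open>y\<close>, f minus its quadratic upper
  model has a nonpositive derivative, by Cauchy-Schwarz and the Lipschitz bound on the
  gradient.\<close>

lemma L_smooth_descent:
  fixes f :: "'a::euclidean_space \<Rightarrow> real"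
  assumes "L_smooth L f"
  shows "f y \<le> f x + inner (y - x) (grad f x) + L / 2 * (norm (y - x))\<^sup>2"
proof -
  let ?d = "y - x"
  define \<phi> where "\<phi> t = f (x + t *\<^sub>R ?d) - t * inner ?d (grad f x) - L / 2 * t\<^sup>2 * (norm ?d)\<^sup>2" for t
  define \<phi>' where "\<phi>' t = inner ?d (grad f (x + t *\<^sub>R ?d)) - inner ?d (grad f x) - L * t * (norm ?d)\<^sup>2" for t
  have "\<phi> 1 \<le> \<phi> 0"
  proof (rule DERIV_nonpos_imp_nonincreasing[of 0 1])
    fix t :: real assume t: "0 \<le> t" "t \<le> 1"
    have "GDERIV f (x + t *\<^sub>R ?d) :> grad f (x + t *\<^sub>R ?d)"
      using assms by (intro GDERIV_grad) (auto simp: L_smooth_def)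
    note D = GDERIV_imp_DERIV_line[OF this]
    have "(\<phi> has_real_derivative \<phi>' t) (at t)"
      unfolding \<phi>_def \<phi>'_def by (rule derivative_eq_intros D refl | simp)+
    moreover have "\<phi>' t \<le> 0"
    proof -
      have "inner ?d (grad f (x + t *\<^sub>R ?d) - grad f x)
          \<le> norm ?d * norm (grad f (x + t *\<^sub>R ?d) - grad f x)"
        by (rule norm_cauchy_schwarz)
      also have "\<dots> \<le> norm ?d * (L * norm (t *\<^sub>R ?d))"
      proof (rule mult_left_mono)
        have "L-lipschitz_on UNIV (grad f)" using assms by (simp add: L_smooth_def)
        from lipschitz_onD[OF this, of "x + t *\<^sub>R ?d" x]
        show "norm (grad f (x + t *\<^sub>R ?d) - grad f x) \<le> L * norm (t *\<^sub>R ?d)"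
          by (simp add: dist_norm)
      qed simp
      also have "\<dots> = L * t * (norm ?d)\<^sup>2" using t by (simp add: power2_eq_square)
      finally show ?thesis by (simp add: \<phi>'_def inner_diff_right)
    qed
    ultimately show "\<exists>D. DERIV \<phi> t :> D \<and> D \<le> 0" by blast
  qed simp
  then show ?thesis by (simp add: \<phi>_def)
qed

text \<open>Baillon-Haddad: the lower bound at \<open>z\<close> based at \<open>x\<close> is compared with the upper bound
  based at \<open>y\<close>, at the minimiser \<open>z = y + (g x - g y) / M\<close> of the difference.\<close>

lemma cocoercive:
  fixes h :: "'a::real_inner \<Rightarrow> real" and g :: "'a \<Rightarrow> 'a"
  assumes M: "M > 0"
    and lower: "\<And>x y. h x + inner (y - x) (g x) \<le> h y"
    and upper: "\<And>x y. h y \<le> h x + inner (y - x) (g x) + M / 2 * (norm (y - x))\<^sup>2"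
  shows "(norm (g x - g y))\<^sup>2 \<le> M * inner (x - y) (g x - g y)"
proof -
  have half: "h x + inner (y - x) (g x) + (norm (g x - g y))\<^sup>2 / (2 * M) \<le> h y" for x y
  proof -
    let ?w = "(1 / M) *\<^sub>R (g x - g y)"
    have "h x + inner (y + ?w - x) (g x) \<le> h y + inner ?w (g y) + M / 2 * (norm ?w)\<^sup>2"
      using lower[of x "y + ?w"] upper[of "y + ?w" y] by simp
    moreover have "inner ?w (g x) - inner ?w (g y) = (norm (g x - g y))\<^sup>2 / M"
      unfolding inner_diff_right[symmetric] by (simp add: power2_norm_eq_inner)
    moreover have "M / 2 * (norm ?w)\<^sup>2 = (norm (g x - g y))\<^sup>2 / (2 * M)"
      using M by (simp add: power_mult_distrib power_divide power2_eq_square)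
    moreover have "(norm (g x - g y))\<^sup>2 / M = 2 * ((norm (g x - g y))\<^sup>2 / (2 * M))"
      using M by simp
    moreover have "inner (y + ?w - x) (g x) = inner (y - x) (g x) + inner ?w (g x)"
      by (simp add: algebra_simps)
    ultimately show ?thesis by linarith
  qed
  \<comment> \<open>Adding the inequality to its copy with \<open>x\<close> and \<open>y\<close>
    exchanged cancels the values of \<open>h\<close>.\<close>
  have "(norm (g x - g y))\<^sup>2 / M \<le> inner (x - y) (g x - g y)"
    using half[of x y] half[of y x] by (simp add: norm_minus_commute inner_diff_left inner_diff_right field_simps)
  then show ?thesis using M by (simp add: field_simps)
qed

text \<open>Subtracting \<open>\<mu> / 2\<close> times the squared norm leaves a convex function
  whose quadratic upper bound has constant \<open>L - \<mu>\<close>; cocoercivity of its gradient,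
  rewritten for f, is the claim.\<close>

lemma strongly_convex_smooth_coercive:
  fixes f :: "'a::euclidean_space \<Rightarrow> real"
  assumes "0 < \<mu>" "\<mu> \<le> L" and sc: "strongly_convex \<mu> f" and sm: "L_smooth L f"
  shows "\<mu> * L * (norm (x - y))\<^sup>2 + (norm (grad f x - grad f y))\<^sup>2
    \<le> (\<mu> + L) * inner (x - y) (grad f x - grad f y)"
proof -
  define h where "h x = f x - \<mu> / 2 * (norm x)\<^sup>2" for x
  define g where "g x = grad f x - \<mu> *\<^sub>R x" for x
  have lower: "h x + inner (y - x) (g x) \<le> h y" for x y
  proof -
    have "GDERIV f x :> grad f x" using sm by (intro GDERIV_grad) (auto simp: L_smooth_def)
    from strongly_convex_first_order[OF sc this, of y] show ?thesis
      by (simp add: h_def g_def power2_norm_eq_inner inner_diff_left inner_diff_right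
          inner_commute algebra_simps)
  qed
  \<comment> \<open>Cocoercivity divides by the smoothness constant, and \<open>L - \<mu>\<close>
    may be zero; the slack \<open>e\<close> keeps it positive and is sent to 0 afterwards.\<close>
  have upper: "h y \<le> h x + inner (y - x) (g x) + (L - \<mu> + e) / 2 * (norm (y - x))\<^sup>2" if "e > 0" for x y e
  proof -
    have "h y \<le> h x + inner (y - x) (g x) + (L - \<mu>) / 2 * (norm (y - x))\<^sup>2"
      using L_smooth_descent[OF sm, of y x]
      by (simp add: h_def g_def power2_norm_eq_inner inner_diff_left inner_diff_right
          inner_commute field_simps)
    also have "\<dots> \<le> h x + inner (y - x) (g x) + (L - \<mu> + e) / 2 * (norm (y - x))\<^sup>2"
      using that by (intro add_left_mono mult_right_mono) auto
    finally show ?thesis .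
  qed
  let ?s = "inner (x - y) (g x - g y)"
  have "(norm (g x - g y))\<^sup>2 \<le> (L - \<mu> + e) * ?s" if "e > 0" for e
    using that \<open>\<mu> \<le> L\<close> by (intro cocoercive[OF _ lower upper]) auto
  then have "eventually (\<lambda>e. (norm (g x - g y))\<^sup>2 \<le> (L - \<mu> + e) * ?s) (at_right 0)"
    by (simp add: eventually_at_right_less eventually_mono[OF eventually_at_right_less])
  moreover have "((\<lambda>e. (L - \<mu> + e) * ?s) \<longlongrightarrow> (L - \<mu> + 0) * ?s) (at_right 0)"
    by (intro tendsto_intros)
  ultimately have "(norm (g x - g y))\<^sup>2 \<le> (L - \<mu> + 0) * ?s"
    by (intro tendsto_lowerbound) auto
  moreover define d where "d = x - y"
  moreover define G where "G = grad f x - grad f y"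
  moreover have "g x - g y = G - \<mu> *\<^sub>R d"
    by (simp add: g_def G_def d_def algebra_simps)
  moreover have "(norm (G - \<mu> *\<^sub>R d))\<^sup>2 = (norm G)\<^sup>2 - 2 * \<mu> * inner d G + \<mu> * (\<mu> * (norm d)\<^sup>2)"
      "inner d (G - \<mu> *\<^sub>R d) = inner d G - \<mu> * (norm d)\<^sup>2"
    by (simp_all add: power2_norm_eq_inner inner_diff_left inner_diff_right inner_commute
        algebra_simps)
  ultimately have "(norm G)\<^sup>2 - 2 * \<mu> * inner d G + \<mu> * (\<mu> * (norm d)\<^sup>2)
      \<le> (L - \<mu>) * (inner d G - \<mu> * (norm d)\<^sup>2)"
    by simp
  then have "\<mu> * L * (norm d)\<^sup>2 + (norm G)\<^sup>2 \<le> (\<mu> + L) * inner d G"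
    by (simp add: algebra_simps)
  then show ?thesis by (simp add: d_def G_def)
qed

lemma gradient_step_contraction:
  fixes f :: "'a::euclidean_space \<Rightarrow> real"
  assumes "0 < \<mu>" "\<mu> \<le> L" "strongly_convex \<mu> f" "L_smooth L f"
    and \<alpha>: "0 < \<alpha>" "\<alpha> \<le> 2 / (\<mu> + L)"
  shows "(norm ((x - \<alpha> *\<^sub>R grad f x) - (y - \<alpha> *\<^sub>R grad f y)))\<^sup>2
    \<le> (1 - 2 * \<alpha> * \<mu> * L / (\<mu> + L)) * (norm (x - y))\<^sup>2"
proof -
  define d where "d = x - y"
  define G where "G = grad f x - grad f y"
  let ?s = "\<mu> + L"
  have s: "?s > 0" using assms by simp
  have "(x - \<alpha> *\<^sub>R grad f x) - (y - \<alpha> *\<^sub>R grad f y) = d - \<alpha> *\<^sub>R G"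
    by (simp add: d_def G_def algebra_simps)
  also have "(norm \<dots>)\<^sup>2 = (norm d)\<^sup>2 - 2 * \<alpha> * inner d G + \<alpha> * (\<alpha> * (norm G)\<^sup>2)"
    by (simp add: power2_norm_eq_inner inner_diff_left inner_diff_right inner_commute algebra_simps)
  also have "\<dots> \<le> (norm d)\<^sup>2 - 2 * \<alpha> * ((\<mu> * L * (norm d)\<^sup>2 + (norm G)\<^sup>2) / ?s)
      + \<alpha> * (2 / ?s * (norm G)\<^sup>2)"
  proof (intro add_mono diff_left_mono mult_left_mono)
    show "(\<mu> * L * (norm d)\<^sup>2 + (norm G)\<^sup>2) / ?s \<le> inner d G"
      using strongly_convex_smooth_coercive[OF assms(1-4), of x y] s
      by (simp add: d_def G_def divide_le_eq mult.commute)
    \<comment> \<open>Here the step-size bound enters: it makes the quadratic term in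
      \<open>G\<close> no larger than the one gained from coercivity, so the two cancel.\<close>
    show "\<alpha> * (norm G)\<^sup>2 \<le> 2 / ?s * (norm G)\<^sup>2"
      using \<alpha> by (intro mult_right_mono) auto
  qed (use \<alpha> in auto)
  also have "\<dots> = (1 - 2 * \<alpha> * \<mu> * L / ?s) * (norm d)\<^sup>2"
    by (simp add: add_divide_distrib algebra_simps)
  finally show ?thesis by (simp add: d_def)
qed

section \<open>Existence of minimizers\<close>

lemma closed_fun_attains_min:
  fixes r :: "'a::metric_space \<Rightarrow> ereal" and g :: "'a \<Rightarrow> real"
  assumes "closed_fun r" "compact K" "K \<noteq> {}" "continuous_on K g" "a > 0"
  shows "\<exists>p\<in>K. \<forall>y\<in>K. ereal a * r p + ereal (g p) \<le> ereal a * r y + ereal (g y)"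
proof -
  let ?\<phi> = "\<lambda>y. ereal a * r y + ereal (g y)"
  \<comment> \<open>Sublevel sets of the sum become membership in the closed epigraph, which
    replaces an appeal to lower semicontinuity.\<close>
  have epi: "?\<phi> y \<le> ereal c \<longleftrightarrow> (y, (c - g y) / a) \<in> ereal_epigraph r" for y c
    using \<open>a > 0\<close> by (cases "r y") (auto simp: ereal_epigraph_def field_simps)
  obtain h where h: "decseq h" "range h \<subseteq> ?\<phi> ` K" "Inf (?\<phi> ` K) = (INF i::nat. h i)"
    using Inf_countable_INF[of "?\<phi> ` K"] \<open>K \<noteq> {}\<close> by auto
  then have "\<forall>i. \<exists>y. y \<in> K \<and> h i = ?\<phi> y" by blast
  from choice[OF this] obtain y where y: "\<And>i. y i \<in> K" "\<And>i. h i = ?\<phi> (y i)" by auto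
  obtain p s where ps: "p \<in> K" "strict_mono s" "(y \<circ> s) \<longlonglongrightarrow> p"
    using \<open>compact K\<close>[unfolded compact_def, rule_format, of y] y(1) by auto
  have "?\<phi> p \<le> ?\<phi> w" if "w \<in> K" for w
  proof (rule ccontr)
    \<comment> \<open>A real level strictly between the two values is eventually undercut by the
      minimizing sequence; closedness carries it to the limit \<open>p\<close>, a contradiction.
      This covers infinite values as well.\<close>
    assume "\<not> ?\<phi> p \<le> ?\<phi> w"
    then obtain c where c: "?\<phi> w < ereal c" "ereal c < ?\<phi> p"
      using ereal_dense2[of "?\<phi> w" "?\<phi> p"] by (auto simp: not_le)
    have "Inf (?\<phi> ` K) < ereal c" using that c(1) by (auto simp: Inf_less_iff)
    then obtain N where N: "h N < ereal c" unfolding h(3) by (auto simp: INF_less_iff)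
    have "eventually (\<lambda>i. (y (s i), (c - g (y (s i))) / a) \<in> ereal_epigraph r) sequentially"
    proof (rule eventually_sequentiallyI)
      fix i assume "N \<le> i"
      then have "N \<le> s i" using seq_suble[OF ps(2)] order_trans by blast
      then have "h (s i) \<le> h N" by (rule decseqD[OF h(1)])
      then have "?\<phi> (y (s i)) \<le> ereal c" using N unfolding y(2)[symmetric] by order
      then show "(y (s i), (c - g (y (s i))) / a) \<in> ereal_epigraph r"
        by (rule epi[THEN iffD1])
    qed
    moreover have "(\<lambda>i. (y (s i), (c - g (y (s i))) / a)) \<longlonglongrightarrow> (p, (c - g p) / a)"
    proof -
      have "(\<lambda>i. g (y (s i))) \<longlonglongrightarrow> g p"
        using assms(4) ps y(1) unfolding continuous_on_sequentially by (auto simp: o_def)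
      moreover have "(\<lambda>i. y (s i)) \<longlonglongrightarrow> p" using ps(3) by (simp add: o_def)
      ultimately show ?thesis using \<open>a > 0\<close> by (intro tendsto_intros) auto
    qed
    ultimately have "(p, (c - g p) / a) \<in> ereal_epigraph r"
      by (intro Lim_in_closed_set[OF assms(1)[unfolded closed_fun_def] _ sequentially_bot])
    then have "?\<phi> p \<le> ereal c" by (rule epi[THEN iffD2])
    then show False using c(2) by order
  qed
  then show ?thesis using ps(1) by blast
qed

text \<open>Phrased with real upper bounds instead of the values of \<open>r\<close>, so that no
  arithmetic with infinities arises.\<close>

lemma convex_fun_jensen:
  assumes cv: "convex_fun r" and "r x \<le> ereal a" "r y \<le> ereal b" "0 \<le> t" "t \<le> 1"
  shows "r (x + t *\<^sub>R (y - x)) \<le> ereal (a + t * (b - a))"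
proof -
  have "(1 - t) *\<^sub>R (x, a) + t *\<^sub>R (y, b) \<in> ereal_epigraph r"
    using assms unfolding convex_fun_def by (intro convexD) (auto simp: ereal_epigraph_def)
  moreover have "(1 - t) *\<^sub>R (x, a) + t *\<^sub>R (y, b) = (x + t *\<^sub>R (y - x), a + t * (b - a))"
    by (simp add: algebra_simps)
  ultimately show ?thesis by (simp add: ereal_epigraph_def)
qed

text \<open>Let \<open>m\<close> be the minimum over the unit ball around a point of finite value
  \<open>r0\<close>, and \<open>c = r0 - m\<close>. Inside the ball \<open>r\<close> is at least
  \<open>r0 - c\<close>. Outside, convexity forbids a decrease faster than slope \<open>c\<close>,
  since otherwise \<open>r\<close> would fall below \<open>m\<close> on the unit sphere. The stated
  bound lies below both.\<close>

lemma closed_convex_linear_lower_bound: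
  fixes r :: "'a::euclidean_space \<Rightarrow> ereal"
  assumes "convex_fun r" "closed_fun r" "proper_fun r"
  obtains x0 r0 c where "r x0 = ereal r0" "c \<ge> 0" "\<And>y. ereal (r0 - c - c * norm (y - x0)) \<le> r y"
proof -
  obtain x0 r0 where r0: "r x0 = ereal r0"
    using \<open>proper_fun r\<close> unfolding proper_fun_def by (metis ereal_cases)
  obtain p where p: "p \<in> cball x0 1" "\<And>y. y \<in> cball x0 1 \<Longrightarrow> r p \<le> r y"
    using closed_fun_attains_min[OF \<open>closed_fun r\<close>, of "cball x0 1" "\<lambda>_. 0" 1]
    by (auto simp flip: zero_ereal_def one_ereal_def)
  have "r p \<le> ereal r0" using p(2)[of x0] r0 by simp
  moreover have "r p \<noteq> -\<infinity>" using \<open>proper_fun r\<close> by (auto simp: proper_fun_def)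
  ultimately obtain m where m: "r p = ereal m" "m \<le> r0" by (cases "r p") auto
  have "ereal (r0 - (r0 - m) - (r0 - m) * norm (y - x0)) \<le> r y" for y
  proof (cases "norm (y - x0) \<le> 1")
    case True
    then have "ereal m \<le> r y" using p(2)[of y] m by (simp add: dist_norm norm_minus_commute)
    moreover have "0 \<le> (r0 - m) * norm (y - x0)" using m by simp
    then have "ereal (r0 - (r0 - m) - (r0 - m) * norm (y - x0)) \<le> ereal m" by simp
    ultimately show ?thesis by (rule order_trans[rotated])
  next
    case False
    let ?l = "norm (y - x0)"
    show ?thesis
    proof (rule ereal_le_real)
      fix b assume b: "r y \<le> ereal b"
      \<comment> \<open>The point where the segment from \<open>x0\<close> to \<open>y\<close>
        crosses the unit sphere.\<close>
      let ?w = "x0 + (1 / ?l) *\<^sub>R (y - x0)"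
      have "r ?w \<le> ereal (r0 + 1 / ?l * (b - r0))"
        using False r0 b by (intro convex_fun_jensen[OF assms(1)]) (auto simp: divide_le_eq_1)
      moreover have "ereal m \<le> r ?w"
        using p(2)[of ?w] m False by (auto simp: dist_norm)
      ultimately have "m \<le> r0 + 1 / ?l * (b - r0)"
        by (metis ereal_less_eq(3) order_trans)
      then have "?l * m \<le> ?l * (r0 + 1 / ?l * (b - r0))" by (intro mult_left_mono) auto
      also have "\<dots> = ?l * r0 + (b - r0)"
        using False by (auto simp: distrib_left)
      finally show "ereal (r0 - (r0 - m) - (r0 - m) * ?l) \<le> ereal b"
        using m by (simp add: algebra_simps)
    qed
  qed
  with r0 m that[of x0 r0 "r0 - m"] show thesis by auto
qed

text \<open>The quadratic growth of \<open>G\<close> beats the at most linear decay of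
  \<open>r\<close>, so the search reduces to a compact ball. It serves both \<open>prox\<close>
  (\<open>G\<close> half a squared distance) and \<open>optimum\<close> (\<open>G\<close> the mean
  of the f i).\<close>

lemma composite_min_exists:
  fixes r :: "'a::euclidean_space \<Rightarrow> ereal" and G :: "'a \<Rightarrow> real"
  assumes r: "convex_fun r" "closed_fun r" "proper_fun r" and "a > 0" "m > 0"
    and cont: "continuous_on UNIV G"
    and sub: "\<And>x. \<exists>g. \<forall>y. G x + inner (y - x) g + m / 2 * (norm (y - x))\<^sup>2 \<le> G y"
  shows "\<exists>p. \<forall>y. ereal a * r p + ereal (G p) \<le> ereal a * r y + ereal (G y)"
proof -
  obtain x0 r0 c where c: "r x0 = ereal r0" "c \<ge> 0" "\<And>y. ereal (r0 - c - c * norm (y - x0)) \<le> r y"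
    using closed_convex_linear_lower_bound[OF r] by blast
  obtain g where g: "\<And>y. G x0 + inner (y - x0) g + m / 2 * (norm (y - x0))\<^sup>2 \<le> G y"
    using sub[of x0] by blast
  let ?\<phi> = "\<lambda>y. ereal a * r y + ereal (G y)"
  let ?A = "norm g + a * c"
  \<comment> \<open>Beyond distance 1 the constant loss \<open>a * c\<close> is at most
    \<open>a * c\<close> times the distance; the second entry is where \<open>m / 2\<close> times
    the squared distance outweighs all linear losses.\<close>
  define R where "R = max 1 (2 * (?A + a * c) / m)"
  have far: "?\<phi> x0 \<le> ?\<phi> y" if "norm (y - x0) > R" for y
  proof -
    let ?l = "norm (y - x0)"
    have l: "?l \<ge> 1" "2 * (?A + a * c) / m \<le> ?l" using that by (auto simp: R_def)
    then have "?A + a * c \<le> m / 2 * ?l" using \<open>m > 0\<close> by (simp add: field_simps)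
    then have "(?A + a * c) * ?l \<le> m / 2 * ?l * ?l" using l by (intro mult_right_mono) auto
    moreover have "a * c * 1 \<le> a * c * ?l" using l c(2) \<open>a > 0\<close> by (intro mult_left_mono) auto
    moreover have "- (norm g * ?l) \<le> inner (y - x0) g"
      using Cauchy_Schwarz_ineq2[of "y - x0" g] by (simp add: abs_le_iff mult.commute)
    ultimately have key: "a * r0 + G x0 \<le> a * (r0 - c - c * ?l) + G y"
      using g[of y] by (simp add: algebra_simps power2_eq_square)
    show ?thesis
    proof (cases "r y")
      case (real b)
      then have "a * (r0 - c - c * ?l) \<le> a * b"
        using c(3)[of y] \<open>a > 0\<close> by (intro mult_left_mono) auto
      then show ?thesis using key real c(1) by simp
    qed (use c(3)[of y] \<open>a > 0\<close> in auto)
  qed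
  obtain p where p: "p \<in> cball x0 R" "\<And>y. y \<in> cball x0 R \<Longrightarrow> ?\<phi> p \<le> ?\<phi> y"
    using closed_fun_attains_min[OF r(2), of "cball x0 R" G a] \<open>a > 0\<close>
      continuous_on_subset[OF cont] by (auto simp: R_def)
  have "?\<phi> p \<le> ?\<phi> y" for y
  proof (cases "y \<in> cball x0 R")
    case False
    then have "?\<phi> x0 \<le> ?\<phi> y" by (intro far) (simp add: dist_norm norm_minus_commute)
    moreover have "?\<phi> p \<le> ?\<phi> x0" by (rule p(2)) (simp add: R_def)
    ultimately show ?thesis by order
  qed (rule p(2))
  then show ?thesis by blast
qed

section \<open>Optimality conditions and the prox map\<close>

text \<open>\<open>prox_point a r x p\<close> is the optimality condition of \<open>p = prox\<^bsub>a r\<^esub>(x)\<close>.\<close>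

definition prox_point :: "real \<Rightarrow> ('a::real_inner \<Rightarrow> ereal) \<Rightarrow> 'a \<Rightarrow> 'a \<Rightarrow> bool" where
  "prox_point a r x p \<longleftrightarrow> r p \<noteq> \<infinity> \<and>
     (\<forall>y. r y \<noteq> \<infinity> \<longrightarrow> 0 \<le> inner (y - p) (p - x) + a * (real_of_ereal (r y) - real_of_ereal (r p)))"

text \<open>Moving from \<open>p\<close> towards \<open>y\<close> by a fraction \<open>t\<close>,
  minimality and convexity of \<open>r\<close> bound the difference quotient of \<open>G\<close>
  from below; let \<open>t\<close> tend to 0. The centre \<open>p - g\<close> makes \<open>p\<close>
  minus the centre equal to the gradient.\<close>

lemma composite_min_variational:
  fixes r :: "'a::euclidean_space \<Rightarrow> ereal" and G :: "'a \<Rightarrow> real"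
  assumes r: "convex_fun r" "proper_fun r" and "a > 0" and g: "GDERIV G p :> g"
    and min: "\<And>y. ereal a * r p + ereal (G p) \<le> ereal a * r y + ereal (G y)"
  shows "prox_point a r (p - g) p"
proof -
  have nm: "r y \<noteq> -\<infinity>" for y using r(2) by (simp add: proper_fun_def)
  obtain x1 where "r x1 \<noteq> \<infinity>" using r(2) by (auto simp: proper_fun_def)
  then have rp: "r p \<noteq> \<infinity>" using min[of x1] nm[of x1] \<open>a > 0\<close> by (cases "r x1") auto
  then obtain s where s: "r p = ereal s" using nm[of p] by (cases "r p") auto
  have "0 \<le> inner (y - p) g + a * (real_of_ereal (r y) - s)" if y: "r y \<noteq> \<infinity>" for y
  proof -
    obtain b where b: "r y = ereal b" using y nm[of y] by (cases "r y") auto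
    have "- a * (b - s) \<le> (G (p + t *\<^sub>R (y - p)) - G p) / t" if t: "0 < t" "t < 1" for t
    proof -
      have "r (p + t *\<^sub>R (y - p)) \<le> ereal (s + t * (b - s))"
        using s b t by (intro convex_fun_jensen[OF r(1)]) auto
      then obtain q where q: "r (p + t *\<^sub>R (y - p)) = ereal q" "q \<le> s + t * (b - s)"
        using nm[of "p + t *\<^sub>R (y - p)"] by (cases "r (p + t *\<^sub>R (y - p))") auto
      have "a * q \<le> a * (s + t * (b - s))" using q \<open>a > 0\<close> by simp
      then have "- a * (b - s) * t \<le> G (p + t *\<^sub>R (y - p)) - G p"
        using min[of "p + t *\<^sub>R (y - p)"] q(1) s by (simp add: algebra_simps)
      then show ?thesis using t by (simp add: pos_le_divide_eq)
    qed
    then have "eventually (\<lambda>t. - a * (b - s) \<le> (G (p + t *\<^sub>R (y - p)) - G p) / t) (at_right 0)"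
      using eventually_at_right_real[of 0 1] by (auto elim!: eventually_mono)
    then have "- a * (b - s) \<le> inner (y - p) g"
      by (intro tendsto_lowerbound[OF GDERIV_imp_quotient_tendsto[OF g]]) auto
    then show ?thesis using b by simp
  qed
  then show ?thesis using rp s by (simp add: prox_point_def)
qed

text \<open>Testing each optimality condition at the other point and adding cancels the values of
  \<open>r\<close>; Cauchy-Schwarz does the rest.\<close>

lemma prox_point_nonexpansive:
  assumes "prox_point a r x p" "prox_point a r y q"
  shows "norm (p - q) \<le> norm (x - y)"
proof -
  have "0 \<le> inner (q - p) (p - x) + inner (p - q) (q - y)"
    using assms unfolding prox_point_def by (smt (verit) right_diff_distrib)
  then have "(norm (p - q))\<^sup>2 \<le> inner (p - q) (x - y)"
    by (simp add: power2_norm_eq_inner inner_diff_left inner_diff_right inner_commute)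
  also have "\<dots> \<le> norm (p - q) * norm (x - y)" by (rule norm_cauchy_schwarz)
  finally show ?thesis
    by (cases "norm (p - q) = 0") (auto simp: power2_eq_square)
qed

lemma prox_point_prox:
  fixes r :: "'a::euclidean_space \<Rightarrow> ereal"
  assumes r: "convex_fun r" "closed_fun r" "proper_fun r" and "a > 0"
  shows "prox_point a r x (prox a r x)"
proof -
  define G where "G y = 1 / 2 * (norm (y - x))\<^sup>2" for y
  have D: "GDERIV G y :> y - x" for y
    unfolding G_def gderiv_def power2_norm_eq_inner
    by (auto intro!: derivative_eq_intros simp: inner_commute)
  have "G u + inner (y - u) (u - x) + 1 / 2 * (norm (y - u))\<^sup>2 \<le> G y" for u y
    by (simp add: G_def power2_norm_eq_inner inner_diff_left inner_diff_right inner_commute field_simps)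
  then have "\<exists>p. \<forall>y. ereal a * r p + ereal (G p) \<le> ereal a * r y + ereal (G y)"
    by (intro composite_min_exists[OF r \<open>a > 0\<close>, of 1]) 
       (auto simp: G_def intro!: continuous_intros)
  then have "\<exists>p. is_arg_min (\<lambda>y. ereal a * r y + ereal (G y)) (\<lambda>_. True) p"
    by (simp add: is_arg_min_def not_less)
  then have "is_arg_min (\<lambda>y. ereal a * r y + ereal (G y)) (\<lambda>_. True) (prox a r x)"
    unfolding prox_def arg_min_def G_def by (rule someI_ex)
  then have "ereal a * r (prox a r x) + ereal (G (prox a r x)) \<le> ereal a * r y + ereal (G y)" for y
    by (simp add: is_arg_min_def not_less)
  from composite_min_variational[OF r(1,3) \<open>a > 0\<close> D this] show ?thesis by simp
qed

text \<open>Links the optimum to the algorithm: the mean of the blocks of \<open>zstar\<close> is a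
  gradient step of the averaged function from the optimum, and the optimality condition says that
  prox undoes it.\<close>

lemma prox_point_optimum:
  fixes f :: "nat \<Rightarrow> 'a::euclidean_space \<Rightarrow> real" and r :: "'a \<Rightarrow> ereal"
  assumes "n \<ge> 1" "0 < \<mu>"
    and sc: "\<And>i. i \<in> {1..n} \<Longrightarrow> strongly_convex \<mu> (f i)"
    and sm: "\<And>i. i \<in> {1..n} \<Longrightarrow> L_smooth L (f i)"
    and r: "convex_fun r" "closed_fun r" "proper_fun r" and "0 < \<alpha>"
  shows "prox_point \<alpha> r (avg n (zstar n \<alpha> f r)) (optimum n f r)"
proof -
  define F where "F x = avg n (\<lambda>i. f i x)" for x
  define gF where "gF x = avg n (\<lambda>i. grad (f i) x)" for x
  have Di: "GDERIV (f i) x :> grad (f i) x" if "i \<in> {1..n}" for i x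
    using sm[OF that] by (intro GDERIV_grad) (auto simp: L_smooth_def)
  have D: "GDERIV F x :> gF x" for x
    using Di unfolding F_def gF_def avg_def gderiv_def inner_scaleR_right inner_sum_right real_scaleR_def
    by (intro has_derivative_mult_right has_derivative_sum) auto
  have sub: "F x + inner (y - x) (gF x) + \<mu> / 2 * (norm (y - x))\<^sup>2 \<le> F y" for x y
  proof -
    have "(\<Sum>i\<in>{1..n}. f i x + inner (y - x) (grad (f i) x) + \<mu> / 2 * (norm (y - x))\<^sup>2) \<le> (\<Sum>i\<in>{1..n}. f i y)"
      using strongly_convex_first_order[OF sc Di] by (intro sum_mono) auto
    then have "(\<Sum>i\<in>{1..n}. f i x) + inner (y - x) (\<Sum>i\<in>{1..n}. grad (f i) x)
        + real n * (\<mu> / 2 * (norm (y - x))\<^sup>2) \<le> (\<Sum>i\<in>{1..n}. f i y)"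
      by (simp add: sum.distrib inner_sum_right)
    from mult_left_mono[OF this, of "1 / real n"] show ?thesis
      using \<open>n \<ge> 1\<close> by (simp add: F_def gF_def avg_def add_divide_distrib)
  qed
  have "continuous_on UNIV F"
    using D unfolding gderiv_def by (meson continuous_at_imp_continuous_on has_derivative_continuous)
  then have "\<exists>p. \<forall>y. ereal 1 * r p + ereal (F p) \<le> ereal 1 * r y + ereal (F y)"
    using sub by (intro composite_min_exists[OF r _ \<open>0 < \<mu>\<close>]) auto
  then have "\<exists>p. is_arg_min (\<lambda>y. ereal (F y) + r y) (\<lambda>_. True) p"
    by (simp add: is_arg_min_def not_less add.commute flip: one_ereal_def)
  then have "is_arg_min (\<lambda>y. ereal (F y) + r y) (\<lambda>_. True) (optimum n f r)"
    unfolding optimum_def arg_min_def F_def by (rule someI_ex)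
  then have "ereal 1 * r (optimum n f r) + ereal (F (optimum n f r)) \<le> ereal 1 * r y + ereal (F y)" for y
    by (simp add: is_arg_min_def not_less add.commute flip: one_ereal_def)
  from composite_min_variational[OF r(1,3) _ D this]
  have "prox_point 1 r (optimum n f r - gF (optimum n f r)) (optimum n f r)" by simp
  moreover have "avg n (zstar n \<alpha> f r) = optimum n f r - \<alpha> *\<^sub>R gF (optimum n f r)"
    using \<open>n \<ge> 1\<close>
    by (simp add: avg_def zstar_def gF_def sum_subtractf scaleR_diff_right flip: scaleR_sum_right)
       (simp add: sum_constant_scaleR)
  \<comment> \<open>Optimality was obtained with weight 1 on \<open>r\<close>; multiplying by
    \<open>\<alpha>\<close> gives the condition for step size \<open>\<alpha>\<close>.\<close>
  moreover have "0 \<le> u + \<alpha> * v" if "0 \<le> u / \<alpha> + v" for u v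
    using mult_nonneg_nonneg[of \<alpha> "u / \<alpha> + v"] that \<open>0 < \<alpha>\<close> by (simp add: algebra_simps)
  ultimately show ?thesis using \<open>0 < \<alpha>\<close> by (auto simp: prox_point_def)
qed

section \<open>Weighted estimates and one sweep\<close>

lemma norm_sum_squared_weighted:
  fixes v :: "'b \<Rightarrow> 'a::real_normed_vector"
  assumes "\<And>i. i \<in> I \<Longrightarrow> 0 < w i"
  shows "(norm (\<Sum>i\<in>I. v i))\<^sup>2 \<le> (\<Sum>i\<in>I. 1 / w i) * (\<Sum>i\<in>I. w i * (norm (v i))\<^sup>2)"
proof -
  have "norm (\<Sum>i\<in>I. v i) \<le> (\<Sum>i\<in>I. norm (v i))" by (rule norm_sum)
  also have "\<dots> = (\<Sum>i\<in>I. (1 / sqrt (w i)) * (sqrt (w i) * norm (v i)))"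
    using assms by (intro sum.cong) (auto simp: less_imp_neq[symmetric])
  finally have "(norm (\<Sum>i\<in>I. v i))\<^sup>2 \<le> (\<Sum>i\<in>I. (1 / sqrt (w i)) * (sqrt (w i) * norm (v i)))\<^sup>2"
    by (intro power_mono) auto
  also have "\<dots> \<le> (\<Sum>i\<in>I. (1 / sqrt (w i))\<^sup>2) * (\<Sum>i\<in>I. (sqrt (w i) * norm (v i))\<^sup>2)"
    by (rule Cauchy_Schwarz_ineq_sum)
  also have "\<dots> = (\<Sum>i\<in>I. 1 / w i) * (\<Sum>i\<in>I. w i * (norm (v i))\<^sup>2)"
    using assms by (intro arg_cong2[of _ _ _ _ "(*)"] sum.cong)
      (auto simp: power_divide power_mult_distrib less_imp_le)
  finally show ?thesis .
qed

lemma norm_avg_diff_squared: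
  "(norm (avg n u - avg n v))\<^sup>2 = (norm (\<Sum>i\<in>{1..n}. u i - v i))\<^sup>2 / (real n)\<^sup>2"
  by (simp add: avg_def sum_subtractf power_divide flip: scaleR_diff_right)

text \<open>The harmonic number minus the logarithm decreases from its value 1 at n = 1.\<close>

lemma sum_inverse_le_ln:
  assumes "n \<ge> 1"
  shows "(\<Sum>i\<in>{1..n}. 1 / real i) \<le> ln (real n) + 1"
  using euler_mascheroni_sequence_decreasing[of 1 n] assms by (simp add: harm_def inverse_eq_divide)

lemma norm_convex_combination_squared_le:
  fixes u v :: "'a::real_inner"
  assumes "0 \<le> t" "t \<le> 1"
  shows "(norm ((1 - t) *\<^sub>R u + t *\<^sub>R v))\<^sup>2 \<le> (1 - t) * (norm u)\<^sup>2 + t * (norm v)\<^sup>2"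
proof -
  have "(1 - t) * (norm u)\<^sup>2 + t * (norm v)\<^sup>2 - (norm ((1 - t) *\<^sub>R u + t *\<^sub>R v))\<^sup>2
      = t * (1 - t) * (norm (u - v))\<^sup>2"
    by (simp add: power2_norm_eq_inner inner_diff_left inner_diff_right inner_add_left
        inner_add_right inner_commute algebra_simps)
  also have "\<dots> \<ge> 0" using assms by simp
  finally show ?thesis by simp
qed

text \<open>The weights \<open>1, \<dots>, n\<close> rank the blocks by how late they are refreshed. Replacing a block
  by the average moves it from the lowest rank to the highest and lowers all others by one, which
  for \<open>\<rho> = 1\<close> leaves the weighted sum unchanged.\<close>

lemma sweep_contraction:
  fixes a b :: "nat \<Rightarrow> real"
  assumes b: "\<And>j. j \<in> {1..n} \<Longrightarrow> 0 \<le> b j" and \<rho>: "\<rho> \<le> 1"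
    and sweep: "\<And>j. j \<in> {1..n} \<Longrightarrow>
      real n * b j \<le> \<rho> * (\<Sum>i\<in>{1..n}. if i < j then b i else a i)"
  shows "(\<Sum>i\<in>{1..n}. real i * b i) \<le> \<rho> * (\<Sum>i\<in>{1..n}. real i * a i)"
proof -
  \<comment> \<open>Refresh number \<open>j\<close> reads the old value of block \<open>i\<close>
    exactly when \<open>j \<le> i\<close>: a block still counts as old at its own refresh.\<close>
  have count: "(\<Sum>j\<in>{1..n}. if i < j then b i else a i) = (real n - real i) * b i + real i * a i"
    if "i \<in> {1..n}" for i
  proof -
    have "{1..n} = {1..i} \<union> {i<..n}" using that by auto
    moreover have "(\<Sum>j\<in>{1..i} \<union> {i<..n}. if i < j then b i else a i)
        = (\<Sum>j\<in>{1..i}. if i < j then b i else a i) + (\<Sum>j\<in>{i<..n}. if i < j then b i else a i)"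
      by (rule sum.union_disjoint) auto
    ultimately have "(\<Sum>j\<in>{1..n}. if i < j then b i else a i)
        = (\<Sum>j\<in>{1..i}. if i < j then b i else a i) + (\<Sum>j\<in>{i<..n}. if i < j then b i else a i)"
      by (simp only:)
    also have "\<dots> = (\<Sum>j\<in>{1..i}. a i) + (\<Sum>j\<in>{i<..n}. b i)"
      by (intro arg_cong2[of _ _ _ _ "(+)"] sum.cong) auto
    finally show ?thesis using that by (simp add: of_nat_diff)
  qed
  have "real n * (\<Sum>j\<in>{1..n}. b j) \<le> (\<Sum>j\<in>{1..n}. \<rho> * (\<Sum>i\<in>{1..n}. if i < j then b i else a i))"
    unfolding sum_distrib_left[of "real n"] by (intro sum_mono sweep)
  also have "\<dots> = \<rho> * (\<Sum>i\<in>{1..n}. \<Sum>j\<in>{1..n}. if i < j then b i else a i)"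
    unfolding sum_distrib_left[symmetric] by (subst sum.swap) simp
  also have "\<dots> = \<rho> * ((\<Sum>i\<in>{1..n}. (real n - real i) * b i) + (\<Sum>i\<in>{1..n}. real i * a i))"
    using count by (simp add: sum.distrib)
  finally have "real n * (\<Sum>j\<in>{1..n}. b j)
      \<le> \<rho> * (\<Sum>i\<in>{1..n}. (real n - real i) * b i) + \<rho> * (\<Sum>i\<in>{1..n}. real i * a i)"
    by (simp add: distrib_left)
  \<comment> \<open>The factor is given up on the new values, so that subtracting them from the left
    side leaves precisely the weights \<open>real i\<close>.\<close>
  moreover have "\<rho> * (\<Sum>i\<in>{1..n}. (real n - real i) * b i) \<le> 1 * (\<Sum>i\<in>{1..n}. (real n - real i) * b i)"
    using \<rho> b by (intro mult_right_mono sum_nonneg) auto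
  moreover have "(\<Sum>i\<in>{1..n}. (real n - real i) * b i)
      = real n * (\<Sum>j\<in>{1..n}. b j) - (\<Sum>i\<in>{1..n}. real i * b i)"
    by (simp add: left_diff_distrib sum_subtractf sum_distrib_left)
  ultimately show ?thesis by linarith
qed

section \<open>Prox-DFinito over one and several epochs\<close>

lemma snd_updates_eq_avg:
  assumes "n \<ge> 1" and s: "snd s = avg n (fst s)"
    and idx: "\<And>j. j \<in> {1..m} \<Longrightarrow> idx (t0 + j) \<in> {1..n}"
  shows "snd (updates n \<alpha> f r idx t0 m s) = avg n (fst (updates n \<alpha> f r idx t0 m s))"
  using idx
proof (induction m)
  case (Suc m)
  let ?u = "updates n \<alpha> f r idx t0 m s" and ?i = "idx (t0 + Suc m)"
  have i: "?i \<in> {1..n}" by (rule Suc.prems) simp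
  have "avg n ((fst ?u)(?i := w)) = avg n (fst ?u) + (1 / real n) *\<^sub>R (w - fst ?u ?i)" for w
  proof -
    have "(\<Sum>j\<in>{1..n}. ((fst ?u)(?i := w)) j) = w + (\<Sum>j\<in>{1..n} - {?i}. fst ?u j)"
      using i by (subst sum.remove[of _ ?i]) auto
    moreover have "(\<Sum>j\<in>{1..n}. fst ?u j) = fst ?u ?i + (\<Sum>j\<in>{1..n} - {?i}. fst ?u j)"
      using i by (subst sum.remove[of _ ?i]) auto
    ultimately show ?thesis by (simp add: avg_def flip: scaleR_add_right)
  qed
  moreover have "snd ?u = avg n (fst ?u)" using Suc by simp
  ultimately show ?case by (simp add: update_def case_prod_beta Let_def del: add_Suc_right fun_upd_apply)
qed (simp add: s)

text \<open>A permutation writes every block exactly once per sweep. The block at position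
  \<open>i\<close> is written from the average left by the first \<open>i - 1\<close>
  updates.\<close>

lemma fst_updates:
  assumes \<pi>: "\<pi> permutes {1..n}" and idx: "\<And>j. j \<in> {1..n} \<Longrightarrow> idx (t0 + j) = \<pi> j"
    and "m \<le> n" "i \<in> {1..n}"
  shows "fst (updates n \<alpha> f r idx t0 m s) (\<pi> i) =
    (if i \<le> m
     then let x = prox \<alpha> r (snd (updates n \<alpha> f r idx t0 (i - 1) s)) in x - \<alpha> *\<^sub>R grad (f (\<pi> i)) x
     else fst s (\<pi> i))"
  using \<open>m \<le> n\<close>
proof (induction m)
  case (Suc m)
  have "idx (t0 + Suc m) = \<pi> (Suc m)" using Suc.prems by (intro idx) auto
  moreover have "\<pi> i = \<pi> (Suc m) \<longleftrightarrow> i = Suc m" using permutes_inj[OF \<pi>] by (auto dest: injD)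
  ultimately show ?case
    using Suc by (auto simp: update_def case_prod_beta Let_def simp del: add_Suc_right)
qed (use \<open>i \<in> {1..n}\<close> in simp)

text \<open>Supplies the refresh inequalities for \<open>sweep_contraction\<close>, with blocks
  indexed by position in the sweep; \<open>contr\<close> packages the gradient step with the
  nonexpansiveness of prox.\<close>

lemma updates_weighted_contraction:
  fixes f :: "nat \<Rightarrow> 'a::real_inner \<Rightarrow> real"
  assumes "n \<ge> 1" "0 \<le> \<rho>" "\<rho> \<le> 1" and \<pi>: "\<pi> permutes {1..n}"
    and idx: "\<And>j. j \<in> {1..n} \<Longrightarrow> idx (t0 + j) = \<pi> j" and s: "snd s = avg n (fst s)"
    and contr: "\<And>i zb. i \<in> {1..n} \<Longrightarrow>
      (norm (prox \<alpha> r zb - \<alpha> *\<^sub>R grad (f i) (prox \<alpha> r zb) - zs i))\<^sup>2 \<le> \<rho> * (norm (zb - avg n zs))\<^sup>2"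
  shows "(\<Sum>i\<in>{1..n}. real i * (norm (fst (updates n \<alpha> f r idx t0 n s) (\<pi> i) - zs (\<pi> i)))\<^sup>2)
    \<le> \<rho> * (\<Sum>i\<in>{1..n}. real i * (norm (fst s (\<pi> i) - zs (\<pi> i)))\<^sup>2)"
proof (rule sweep_contraction[OF _ \<open>\<rho> \<le> 1\<close>])
  fix j assume j: "j \<in> {1..n}"
  let ?u = "\<lambda>m. updates n \<alpha> f r idx t0 m s"
  let ?b = "\<lambda>i. (norm (fst (?u n) (\<pi> i) - zs (\<pi> i)))\<^sup>2"
  let ?a = "\<lambda>i. (norm (fst s (\<pi> i) - zs (\<pi> i)))\<^sup>2"
  have \<pi>in: "\<pi> i \<in> {1..n}" if "i \<in> {1..n}" for i using permutes_in_image[OF \<pi>] that by blast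
  have zb: "snd (?u (j - 1)) = avg n (fst (?u (j - 1)))"
    using j idx \<pi>in by (intro snd_updates_eq_avg[OF \<open>n \<ge> 1\<close> s]) auto
  have fu: "fst (?u m) (\<pi> i) = (if i \<le> m
      then let x = prox \<alpha> r (snd (?u (i - 1))) in x - \<alpha> *\<^sub>R grad (f (\<pi> i)) x
      else fst s (\<pi> i))" if "m \<le> n" "i \<in> {1..n}" for m i
    by (rule fst_updates[OF \<pi> idx that])
  have "?b j \<le> \<rho> * (norm (snd (?u (j - 1)) - avg n zs))\<^sup>2"
    using contr[OF \<pi>in[OF j], of "snd (?u (j - 1))"] j
    by (simp add: fu Let_def)
  also have "\<dots> = \<rho> * ((norm (\<Sum>i\<in>{1..n}. fst (?u (j - 1)) i - zs i))\<^sup>2 / (real n)\<^sup>2)"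
    unfolding zb norm_avg_diff_squared ..
  \<comment> \<open>Cauchy-Schwarz with unit weights: the squared error of the mean is at most the
    mean squared error.\<close>
  also have "\<dots> \<le> \<rho> * ((real n * (\<Sum>i\<in>{1..n}. (norm (fst (?u (j - 1)) i - zs i))\<^sup>2)) / (real n)\<^sup>2)"
    using norm_sum_squared_weighted[of "{1..n}" "\<lambda>_. 1" "\<lambda>i. fst (?u (j - 1)) i - zs i"] \<open>0 \<le> \<rho>\<close>
    by (intro mult_left_mono divide_right_mono) auto
  also have "(\<Sum>i\<in>{1..n}. (norm (fst (?u (j - 1)) i - zs i))\<^sup>2)
      = (\<Sum>i\<in>{1..n}. (norm (fst (?u (j - 1)) (\<pi> i) - zs (\<pi> i)))\<^sup>2)"
    using sum.permute[OF \<pi>, of "\<lambda>i. (norm (fst (?u (j - 1)) i - zs i))\<^sup>2"] by (simp add: o_def)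
  also have "\<dots> = (\<Sum>i\<in>{1..n}. if i < j then ?b i else ?a i)"
  proof (intro sum.cong refl)
    fix i assume i: "i \<in> {1..n}"
    have "fst (?u (j - 1)) (\<pi> i) = (if i < j then fst (?u n) (\<pi> i) else fst s (\<pi> i))"
      using fu[of "j - 1" i] fu[OF order_refl i] i j by auto
    then show "(norm (fst (?u (j - 1)) (\<pi> i) - zs (\<pi> i)))\<^sup>2 = (if i < j then ?b i else ?a i)"
      by simp
  qed
  finally have "?b j \<le> \<rho> * (real n * (\<Sum>i\<in>{1..n}. if i < j then ?b i else ?a i) / (real n)\<^sup>2)" .
  from mult_left_mono[OF this, of "real n"]
  show "real n * ?b j \<le> \<rho> * (\<Sum>i\<in>{1..n}. if i < j then ?b i else ?a i)"
    using \<open>n \<ge> 1\<close> by (simp add: power2_eq_square)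
qed simp

lemma cyclic_order_epoch:
  assumes "j \<in> {1..n}"
  shows "cyclic_order n \<pi> (k * n + j) = \<pi> j"
proof -
  have "(k * n + j - 1) mod n = (j - 1 + k * n) mod n"
    using assms by (intro arg_cong[of _ _ "\<lambda>t. t mod n"]) auto
  also have "\<dots> = j - 1" using assms by (simp only: mod_mult_self1) auto
  finally show ?thesis using assms by (simp add: cyclic_order_def)
qed

text \<open>Damping applies the same combination to the blocks and to the running average, and
  averaging is linear.\<close>

lemma snd_epoch_state_eq_avg:
  assumes "n \<ge> 1" and \<pi>: "\<pi> permutes {1..n}"
  shows "snd (epoch_state n \<alpha> \<theta> f r (cyclic_order n \<pi>) z0 k)
    = avg n (fst (epoch_state n \<alpha> \<theta> f r (cyclic_order n \<pi>) z0 k))"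
proof (induction k)
  case (Suc k)
  let ?s = "epoch_state n \<alpha> \<theta> f r (cyclic_order n \<pi>) z0 k"
  let ?u = "updates n \<alpha> f r (cyclic_order n \<pi>) (k * n) n ?s"
  have "snd ?u = avg n (fst ?u)"
    using permutes_in_image[OF \<pi>] by (intro snd_updates_eq_avg[OF \<open>n \<ge> 1\<close> Suc]) (simp add: cyclic_order_epoch)
  with Suc show ?case
    by (simp add: damp_def Let_def case_prod_beta avg_def sum.distrib scaleR_add_right
        flip: scaleR_sum_right)
qed simp

lemma epoch_state_weighted_contraction:
  fixes f :: "nat \<Rightarrow> 'a::real_inner \<Rightarrow> real"
  assumes "n \<ge> 1" "0 \<le> \<rho>" "\<rho> \<le> 1" "0 \<le> \<theta>" "\<theta> \<le> 1" and \<pi>: "\<pi> permutes {1..n}"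
    and contr: "\<And>i zb. i \<in> {1..n} \<Longrightarrow>
      (norm (prox \<alpha> r zb - \<alpha> *\<^sub>R grad (f i) (prox \<alpha> r zb) - zs i))\<^sup>2 \<le> \<rho> * (norm (zb - avg n zs))\<^sup>2"
  shows "(\<Sum>i\<in>{1..n}. real i *
      (norm (fst (epoch_state n \<alpha> \<theta> f r (cyclic_order n \<pi>) z0 k) (\<pi> i) - zs (\<pi> i)))\<^sup>2)
    \<le> (1 - \<theta> * (1 - \<rho>)) ^ k * (\<Sum>i\<in>{1..n}. real i * (norm (z0 (\<pi> i) - zs (\<pi> i)))\<^sup>2)"
proof (induction k)
  case (Suc k)
  let ?s = "epoch_state n \<alpha> \<theta> f r (cyclic_order n \<pi>) z0 k"
  let ?u = "updates n \<alpha> f r (cyclic_order n \<pi>) (k * n) n ?s"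
  let ?\<Phi> = "\<lambda>z. \<Sum>i\<in>{1..n}. real i * (norm (z (\<pi> i) - zs (\<pi> i)))\<^sup>2"
  \<comment> \<open>The damped factor must be nonnegative for the induction hypothesis to be
    multiplied by it.\<close>
  have q: "0 \<le> 1 - \<theta> * (1 - \<rho>)" using assms(2-5) mult_left_le[of "1 - \<rho>" \<theta>] by simp
  have u: "?\<Phi> (fst ?u) \<le> \<rho> * ?\<Phi> (fst ?s)"
    by (rule updates_weighted_contraction[OF assms(1-3) \<pi> cyclic_order_epoch
        snd_epoch_state_eq_avg[OF assms(1) \<pi>] contr])
  have "?\<Phi> (fst (epoch_state n \<alpha> \<theta> f r (cyclic_order n \<pi>) z0 (Suc k)))
      = ?\<Phi> (\<lambda>i. (1 - \<theta>) *\<^sub>R fst ?s i + \<theta> *\<^sub>R fst ?u i)"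
    by (simp add: damp_def Let_def case_prod_beta)
  also have "\<dots> \<le> (\<Sum>i\<in>{1..n}. real i * ((1 - \<theta>) * (norm (fst ?s (\<pi> i) - zs (\<pi> i)))\<^sup>2
      + \<theta> * (norm (fst ?u (\<pi> i) - zs (\<pi> i)))\<^sup>2))"
  proof (intro sum_mono mult_left_mono)
    fix i
    have "(1 - \<theta>) *\<^sub>R fst ?s (\<pi> i) + \<theta> *\<^sub>R fst ?u (\<pi> i) - zs (\<pi> i)
        = (1 - \<theta>) *\<^sub>R (fst ?s (\<pi> i) - zs (\<pi> i)) + \<theta> *\<^sub>R (fst ?u (\<pi> i) - zs (\<pi> i))"
      by (simp add: algebra_simps)
    then show "(norm ((1 - \<theta>) *\<^sub>R fst ?s (\<pi> i) + \<theta> *\<^sub>R fst ?u (\<pi> i) - zs (\<pi> i)))\<^sup>2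
        \<le> (1 - \<theta>) * (norm (fst ?s (\<pi> i) - zs (\<pi> i)))\<^sup>2 + \<theta> * (norm (fst ?u (\<pi> i) - zs (\<pi> i)))\<^sup>2"
      using norm_convex_combination_squared_le[OF assms(4,5)] by simp
  qed simp
  also have "\<dots> = (1 - \<theta>) * ?\<Phi> (fst ?s) + \<theta> * ?\<Phi> (fst ?u)"
    unfolding sum_distrib_left sum.distrib[symmetric]
    by (intro sum.cong refl) (simp add: algebra_simps)
  also have "\<dots> \<le> (1 - \<theta>) * ?\<Phi> (fst ?s) + \<theta> * (\<rho> * ?\<Phi> (fst ?s))"
    using u \<open>0 \<le> \<theta>\<close> by (intro add_left_mono mult_left_mono)
  also have "\<dots> = (1 - \<theta> * (1 - \<rho>)) * ?\<Phi> (fst ?s)" by (simp add: algebra_simps)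
  also have "\<dots> \<le> (1 - \<theta> * (1 - \<rho>)) * ((1 - \<theta> * (1 - \<rho>)) ^ k * ?\<Phi> z0)"
    using Suc q by (intro mult_left_mono)
  finally show ?case by (simp add: mult.assoc)
qed simp

section \<open>Averaging over random permutations\<close>

text \<open>Composing with the transposition of \<open>i\<close> and \<open>j\<close> is a bijection
  of the permutations, so the sum is the same for every position; summed over all positions, each
  permutation contributes the full sum of \<open>h\<close>.\<close>

lemma sum_permutations_apply:
  fixes h :: "'a \<Rightarrow> real"
  assumes "finite S" "i \<in> S"
  shows "real (card S) * (\<Sum>\<pi> | \<pi> permutes S. h (\<pi> i)) = fact (card S) * (\<Sum>j\<in>S. h j)"
proof -
  have "(\<Sum>\<pi> | \<pi> permutes S. h (\<pi> i)) = (\<Sum>\<pi> | \<pi> permutes S. h (\<pi> j))" if "j \<in> S" for j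
    using sum_permutations_compose_right[OF permutes_swap_id[OF assms(2) that], of "\<lambda>\<pi>. h (\<pi> i)"]
    by simp
  then have "real (card S) * (\<Sum>\<pi> | \<pi> permutes S. h (\<pi> i)) = (\<Sum>j\<in>S. \<Sum>\<pi> | \<pi> permutes S. h (\<pi> j))"
    unfolding sum_constant[symmetric] by (rule sum.cong[OF refl])
  also have "\<dots> = (\<Sum>\<pi> | \<pi> permutes S. \<Sum>j\<in>S. h (\<pi> j))" by (rule sum.swap)
  also have "\<dots> = (\<Sum>\<pi> | \<pi> permutes S. \<Sum>j\<in>S. h j)"
    by (rule sum.cong[OF refl]) (simp add: sum.permute[of _ S h] o_def)
  finally show ?thesis using card_permutations[OF refl assms(1)] by simp
qed

lemma expectation_uniform_perm:
  fixes h :: "(nat \<Rightarrow> nat) \<Rightarrow> real"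
  shows   "measure_pmf.expectation (uniform_perm n) h = (\<Sum>\<pi> | \<pi> permutes {1..n}. h \<pi>) / fact n"
proof -
  have ne: "{\<pi>. \<pi> permutes {1..n}} \<noteq> {}" using permutes_id by blast
  show ?thesis
    unfolding uniform_perm_def integral_pmf_of_set[OF ne finite_permutations[OF finite_atLeastAtMost]]
      card_permutations[OF refl finite_atLeastAtMost] by simp
qed

text \<open>Every position sees the mean of \<open>h\<close>, and the weights add up to n (n + 1) /
  2.\<close>

lemma expectation_uniform_perm_weighted:
  fixes h :: "nat \<Rightarrow> real"
  shows   "measure_pmf.expectation (uniform_perm n) (\<lambda>\<pi>. \<Sum>i\<in>{1..n}. real i * h (\<pi> i))
    = (real n + 1) / 2 * (\<Sum>i\<in>{1..n}. h i)"
proof -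
  have *: "(\<Sum>\<pi> | \<pi> permutes {1..n}. h (\<pi> i)) = fact n * (\<Sum>j\<in>{1..n}. h j) / real n" if "i \<in> {1..n}" for i
    using sum_permutations_apply[OF _ that, of h] that by (simp add: field_simps)
  have "(\<Sum>\<pi> | \<pi> permutes {1..n}. \<Sum>i\<in>{1..n}. real i * h (\<pi> i))
      = (\<Sum>i\<in>{1..n}. real i * (\<Sum>\<pi> | \<pi> permutes {1..n}. h (\<pi> i)))"
    unfolding sum_distrib_left by (rule sum.swap)
  also have "\<dots> = (\<Sum>i\<in>{1..n}. real i) * (fact n * (\<Sum>j\<in>{1..n}. h j) / real n)"
    unfolding sum_distrib_right by (intro sum.cong refl) (simp only: *)
  also have "(\<Sum>i\<in>{1..n}. real i) = real n * (real n + 1) / 2"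
    using double_gauss_sum_from_Suc_0[of n, where ?'a = real] by simp
  finally show ?thesis by (cases "n = 0") (simp_all add: expectation_uniform_perm)
qed

theorem mainTheorem5:
  fixes f :: "nat \<Rightarrow> real ^ 'd \<Rightarrow> real"
    and r :: "real ^ 'd \<Rightarrow> ereal"
    and z0 :: "nat \<Rightarrow> real ^ 'd"
    and n k :: nat
    and \<mu> L \<alpha> \<theta> :: real
  assumes "n \<ge> 1"
    and "0 < \<mu>" and "\<mu> \<le> L"
    and "\<And>i. i \<in> {1..n} \<Longrightarrow> strongly_convex \<mu> (f i)"
    and "\<And>i. i \<in> {1..n} \<Longrightarrow> L_smooth L (f i)"
    and "convex_fun r" and "closed_fun r" and "proper_fun r"
    and "0 < \<alpha>" and "\<alpha> \<le> 2 / (\<mu> + L)"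
    and "\<theta> \<in> {0<..<1}"
  shows "measure_pmf.expectation (uniform_perm n)
           (\<lambda>\<pi>. (norm (prox_DFinito n \<alpha> \<theta> f r (cyclic_order n \<pi>) z0 (k * n) - optimum n f r))\<^sup>2)
         \<le> (1 - 2 * \<theta> * \<alpha> * \<mu> * L / (\<mu> + L)) ^ k
            * ((real n + 1) * (ln (real n) + 1) / (2 * (real n)\<^sup>2)
               * (stacked_norm n (\<lambda>i. z0 i - zstar n \<alpha> f r i))\<^sup>2)"
proof -
  define \<rho> where "\<rho> = 1 - 2 * \<alpha> * \<mu> * L / (\<mu> + L)"
  define q where "q = 1 - \<theta> * (1 - \<rho>)"
  let ?xs = "optimum n f r" and ?zs = "zstar n \<alpha> f r"
  let ?h = "\<lambda>i. (norm (z0 i - ?zs i))\<^sup>2"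
  have s: "\<mu> + L > 0" using assms(2,3) by simp
  \<comment> \<open>\<open>\<rho>\<close> is smallest at the largest admissible step, where its
    nonnegativity is the inequality between arithmetic and geometric means of \<open>\<mu>\<close>
    and \<open>L\<close>.\<close>
  have "2 * \<alpha> * \<mu> * L / (\<mu> + L) \<le> 2 * (2 / (\<mu> + L)) * \<mu> * L / (\<mu> + L)"
    using assms s by (intro divide_right_mono mult_right_mono mult_left_mono) auto
  also have "\<dots> = 4 * \<mu> * L / (\<mu> + L)\<^sup>2" by (simp add: power2_eq_square)
  also have "\<dots> \<le> 1"
  proof -
    have "4 * \<mu> * L \<le> (\<mu> + L)\<^sup>2" using sum_squares_bound[of \<mu> L] by (simp add: power2_sum mult.commute)
    then show ?thesis using s by simp
  qed
  finally have \<rho>: "0 \<le> \<rho>" "\<rho> \<le> 1" using assms s by (simp_all add: \<rho>_def)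
  have nonexp: "norm (prox \<alpha> r zb - ?xs) \<le> norm (zb - avg n ?zs)" for zb
    using assms by (intro prox_point_nonexpansive[OF prox_point_prox prox_point_optimum])
  have contr: "(norm (prox \<alpha> r zb - \<alpha> *\<^sub>R grad (f i) (prox \<alpha> r zb) - ?zs i))\<^sup>2
      \<le> \<rho> * (norm (zb - avg n ?zs))\<^sup>2" if "i \<in> {1..n}" for i zb
  proof -
    have "(norm (prox \<alpha> r zb - \<alpha> *\<^sub>R grad (f i) (prox \<alpha> r zb) - ?zs i))\<^sup>2
        \<le> \<rho> * (norm (prox \<alpha> r zb - ?xs))\<^sup>2"
      unfolding \<rho>_def zstar_def using assms that by (intro gradient_step_contraction)
    also have "\<dots> \<le> \<rho> * (norm (zb - avg n ?zs))\<^sup>2"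
      using \<rho> nonexp by (intro mult_left_mono power_mono) auto
    finally show ?thesis .
  qed
  \<comment> \<open>The logarithm bounds the harmonic number from Cauchy-Schwarz, and the square of
    n comes from squaring the mean.\<close>
  define c where "c = (ln (real n) + 1) / (real n)\<^sup>2 * q ^ k"
  have c: "0 \<le> (ln (real n) + 1) / (real n)\<^sup>2" using \<open>n \<ge> 1\<close> by simp
  \<comment> \<open>A pathwise bound: on the right the permutation only decides which initial error
    gets which weight.\<close>
  have bound: "(norm (prox_DFinito n \<alpha> \<theta> f r (cyclic_order n \<pi>) z0 (k * n) - ?xs))\<^sup>2
      \<le> c * (\<Sum>i\<in>{1..n}. real i * ?h (\<pi> i))" if \<pi>: "\<pi> permutes {1..n}" for \<pi>
  proof -
    let ?s = "epoch_state n \<alpha> \<theta> f r (cyclic_order n \<pi>) z0 k"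
    let ?v = "\<lambda>i. fst ?s (\<pi> i) - ?zs (\<pi> i)"
    have "prox_DFinito n \<alpha> \<theta> f r (cyclic_order n \<pi>) z0 (k * n) = prox \<alpha> r (avg n (fst ?s))"
      using \<open>n \<ge> 1\<close> by (simp add: prox_DFinito_def snd_epoch_state_eq_avg[OF _ \<pi>])
    then have "(norm (prox_DFinito n \<alpha> \<theta> f r (cyclic_order n \<pi>) z0 (k * n) - ?xs))\<^sup>2
        \<le> (norm (avg n (fst ?s) - avg n ?zs))\<^sup>2"
      using nonexp by (simp add: power_mono)
    also have "\<dots> = (norm (\<Sum>i\<in>{1..n}. ?v i))\<^sup>2 / (real n)\<^sup>2"
      unfolding norm_avg_diff_squared
      using sum.permute[OF \<pi>, of "\<lambda>i. fst ?s i - ?zs i"] by (simp add: o_def)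
    also have "\<dots> \<le> (\<Sum>i\<in>{1..n}. 1 / real i) * (\<Sum>i\<in>{1..n}. real i * (norm (?v i))\<^sup>2) / (real n)\<^sup>2"
      by (intro divide_right_mono norm_sum_squared_weighted) auto
    also have "\<dots> \<le> (ln (real n) + 1) * (\<Sum>i\<in>{1..n}. real i * (norm (?v i))\<^sup>2) / (real n)\<^sup>2"
      by (intro divide_right_mono mult_right_mono sum_inverse_le_ln sum_nonneg \<open>n \<ge> 1\<close>) auto
    also have "\<dots> = (ln (real n) + 1) / (real n)\<^sup>2 * (\<Sum>i\<in>{1..n}. real i * (norm (?v i))\<^sup>2)"
      by simp
    also have "\<dots> \<le> (ln (real n) + 1) / (real n)\<^sup>2 * (q ^ k * (\<Sum>i\<in>{1..n}. real i * ?h (\<pi> i)))"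
      unfolding q_def using assms(11)
      by (intro mult_left_mono[OF _ c] epoch_state_weighted_contraction \<rho> \<pi> contr \<open>n \<ge> 1\<close>) auto
    finally show ?thesis by (simp add: c_def mult.assoc)
  qed
  have "measure_pmf.expectation (uniform_perm n)
      (\<lambda>\<pi>. (norm (prox_DFinito n \<alpha> \<theta> f r (cyclic_order n \<pi>) z0 (k * n) - ?xs))\<^sup>2)
    \<le> measure_pmf.expectation (uniform_perm n) (\<lambda>\<pi>. c * (\<Sum>i\<in>{1..n}. real i * ?h (\<pi> i)))"
    unfolding expectation_uniform_perm by (intro divide_right_mono sum_mono bound) auto
  also have "\<dots> = c * ((real n + 1) / 2 * (\<Sum>i\<in>{1..n}. ?h i))"
    using expectation_uniform_perm_weighted[of n ?h] by simp
  also have "(\<Sum>i\<in>{1..n}. ?h i) = (stacked_norm n (\<lambda>i. z0 i - ?zs i))\<^sup>2"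
    by (simp add: stacked_norm_def L2_set_def sum_nonneg)
  also have "c * ((real n + 1) / 2 * (stacked_norm n (\<lambda>i. z0 i - ?zs i))\<^sup>2)
      = q ^ k * ((real n + 1) * (ln (real n) + 1) / (2 * (real n)\<^sup>2)
               * (stacked_norm n (\<lambda>i. z0 i - ?zs i))\<^sup>2)"
    by (simp add: c_def mult_ac)
  also have "q = 1 - 2 * \<theta> * \<alpha> * \<mu> * L / (\<mu> + L)" by (simp add: q_def \<rho>_def mult_ac)
  finally show ?thesis .
qed

end
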